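(* Let $q\ge 2$ and $1\le d\le n$ be integers. Each of the following graphs $G$ satisfies $v(G)=\Theta(G)$: 1. $G=H_q(n,d)$, when there exists a $q$-ary perfect code of length $n$ and minimum distance $d$; 2. $G=H_q(n,d)$, when $q\ge n-d+2$ and there exists a $q$-ary MDS code of length $n$ and minimum distance $d$; 3. $G=H_q(n,n)$.
   Context: The Hamming graph $H_q(n,d)$ has vertex set $\Sigma^n$, $\Sigma=\{0,1,\dots,q-1\}$, and two vertices are adjacent iff their Hamming distance (the number of positions in which they differ) is at least $d$. A $q$-ary code of length $n$ is a subset $C\subseteq\Sigma^n$; its minimum distance is the smallest Hamming distance between two distinct codewords. A perfect code of length $n$ and minimum distance $d$ is one attaining the Hamming bound: $|C|=q^n\big/\sum_{i=0}^{\lfloor (d-1)/2\rfloor}\binom{n}{i}(q-1)^i$. An MDS code of length $n$ and minimum distance $d$ is one attaining the Singleton bound: $|C|=q^{n-d+1}$. Codes are not required to be linear. $\Theta(G)$ is the Shannon zero-error capacity of the graph $G$ (in Lovász's normalization): $\Theta(G)=\sup_{k\ge1}\alpha(G^{k})^{1/k}$, where $\alpha$ is the independence number and $G^{k}$ is the $k$-fold strong product of $G$ with itself (two distinct $k$-tuples of vertices are adjacent iff in each coordinate the entries are equal or adjacent in $G$). $v(G)$ is the Lovász theta function of $G$: $v(G)=\min_{c,(u_x)}\max_{x\in V(G)}\frac{1}{(c^{T}u_x)^2}$, where the minimum is over all unit vectors $c$ and all families of unit vectors $(u_x)_{x\in V(G)}$ in a Euclidean space such that $u_x\perp u_y$ whenever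 $x\ne y$ are nonadjacent in $G$. *)

theory Defs
  imports
    "HOL-Library.FuncSet"
    "HOL-Library.Extended_Real"
    "Graph_Theory.Pair_Digraph"
    "Jordan_Normal_Form.Matrix"
begin

text \<open>
  Finite simple graphs are values of type \<^typ>\<open>'a pair_pre_digraph\<close> satisfying
  \<^locale>\<open>pair_graph\<close> (finite, symmetric, loop-free). Tuples of length \<open>n\<close> are extensional
  functions on \<open>{..<n}\<close>, so that equality of tuples is equality of functions.
\<close>

definition words :: "nat \<Rightarrow> nat \<Rightarrow> (nat \<Rightarrow> nat) set" where
  "words q n = {..<n} \<rightarrow>\<^sub>E {..<q}"

definition hamming_dist :: "nat \<Rightarrow> (nat \<Rightarrow> nat) \<Rightarrow> (nat \<Rightarrow> nat) \<Rightarrow> nat" where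
  "hamming_dist n x y = card {i \<in> {..<n}. x i \<noteq> y i}"

definition hamming_graph :: "nat \<Rightarrow> nat \<Rightarrow> nat \<Rightarrow> (nat \<Rightarrow> nat) pair_pre_digraph" where
  "hamming_graph q n d =
     \<lparr> pverts = words q n,
       parcs = {(x, y) \<in> words q n \<times> words q n. hamming_dist n x y \<ge> d} \<rparr>"

text \<open>For \<open>d = 0\<close> the relation would have loops.\<close>

lemma pair_graph_hamming_graph:
  assumes "1 \<le> d"
  shows "pair_graph (hamming_graph q n d)"
proof -
  have fin: "finite (words q n)"
    by (simp add: words_def finite_PiE)
  have comm: "hamming_dist n x y = hamming_dist n y x" for x y
    by (simp add: hamming_dist_def eq_commute)
  have refl0: "hamming_dist n x x = 0" for x
    by (simp add: hamming_dist_def)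
  have "finite {(x, y) \<in> words q n \<times> words q n. d \<le> hamming_dist n x y}"
    by (rule finite_subset[of _ "words q n \<times> words q n"]) (auto simp: fin)
  moreover have "symmetric (with_proj (hamming_graph q n d))"
    by (auto simp: symmetric_def arcs_ends_def arc_to_ends_def hamming_graph_def comm
        intro!: symI)
  ultimately show ?thesis
    using fin refl0 assms
    by unfold_locales (auto simp: hamming_graph_def)
qed

text \<open>The existence of two codewords at distance \<open>d\<close> excludes codes with fewer than two codewords,
  which have no minimum distance.\<close>

definition has_min_distance :: "nat \<Rightarrow> (nat \<Rightarrow> nat) set \<Rightarrow> nat \<Rightarrow> bool" where
  "has_min_distance n C d \<longleftrightarrow>
     (\<exists>x\<in>C. \<exists>y\<in>C. x \<noteq> y \<and> hamming_dist n x y = d) \<and>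
     (\<forall>x\<in>C. \<forall>y\<in>C. x \<noteq> y \<longrightarrow> d \<le> hamming_dist n x y)"

definition perfect_code :: "nat \<Rightarrow> nat \<Rightarrow> nat \<Rightarrow> (nat \<Rightarrow> nat) set \<Rightarrow> bool" where
  "perfect_code q n d C \<longleftrightarrow>
     C \<subseteq> words q n \<and> has_min_distance n C d \<and>
     real (card C) = real (q ^ n) / real (\<Sum>i = 0..(d - 1) div 2. (n choose i) * (q - 1) ^ i)"

definition mds_code :: "nat \<Rightarrow> nat \<Rightarrow> nat \<Rightarrow> (nat \<Rightarrow> nat) set \<Rightarrow> bool" where
  "mds_code q n d C \<longleftrightarrow>
     C \<subseteq> words q n \<and> has_min_distance n C d \<and> card C = q ^ (n - d + 1)"

definition independent_set :: "'a pair_pre_digraph \<Rightarrow> 'a set \<Rightarrow> bool" where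
  "independent_set G S \<longleftrightarrow>
     S \<subseteq> pverts G \<and> (\<forall>x\<in>S. \<forall>y\<in>S. x \<noteq> y \<longrightarrow> (x, y) \<notin> parcs G)"

definition independence_number :: "'a pair_pre_digraph \<Rightarrow> nat" where
  "independence_number G = Max (card ` {S. independent_set G S})"

definition strong_power :: "'a pair_pre_digraph \<Rightarrow> nat \<Rightarrow> (nat \<Rightarrow> 'a) pair_pre_digraph" where
  "strong_power G k =
     \<lparr> pverts = {..<k} \<rightarrow>\<^sub>E pverts G,
       parcs = {(x, y) \<in> ({..<k} \<rightarrow>\<^sub>E pverts G) \<times> ({..<k} \<rightarrow>\<^sub>E pverts G).
                  x \<noteq> y \<and> (\<forall>i<k. x i = y i \<or> (x i, y i) \<in> parcs G)} \<rparr>"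

definition shannon_capacity :: "'a pair_pre_digraph \<Rightarrow> ereal" where
  "shannon_capacity G = (SUP k\<in>{1..}. ereal (root k (real (independence_number (strong_power G k)))))"

definition orthonormal_rep :: "'a pair_pre_digraph \<Rightarrow> nat \<Rightarrow> ('a \<Rightarrow> real vec) \<Rightarrow> bool" where
  "orthonormal_rep G m u \<longleftrightarrow>
     (\<forall>x\<in>pverts G. u x \<in> carrier_vec m \<and> u x \<bullet> u x = 1) \<and>
     (\<forall>x\<in>pverts G. \<forall>y\<in>pverts G. x \<noteq> y \<and> (x, y) \<notin> parcs G \<longrightarrow> u x \<bullet> u y = 0)"

text \<open>
  The quotient is taken in \<^typ>\<open>ereal\<close>, where \<open>1 / 0 = \<infinity>\<close>: a vector \<open>u x\<close> orthogonal to \<open>c\<close>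
  contributes an infinite value, whereas the division of \<^typ>\<open>real\<close> would give \<open>0\<close>.
  The dimension \<open>m\<close> of the Euclidean space ranges over all natural numbers. The infimum is
  attained (by compactness, as dimension \<open>card (pverts G) + 1\<close> suffices), so it is the minimum.
\<close>

definition lovasz_theta :: "'a pair_pre_digraph \<Rightarrow> ereal" where
  "lovasz_theta G =
     Inf {(MAX x\<in>pverts G. 1 / ereal ((c \<bullet> u x)\<^sup>2)) | m c u.
            c \<in> carrier_vec m \<and> c \<bullet> c = 1 \<and> orthonormal_rep G m u}"

end

theory Submission
  imports Defs "HOL-Number_Theory.Cong"
begin

text \<open>
  A family of \<open>m\<close>-element subsets \<open>T x\<close> of a set \<open>W\<close>, one for each vertex, such that nonadjacent
  vertices have disjoint sets, bounds both quantities above by \<open>|W| / m\<close>: products of these sets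
  pack disjointly into \<open>W\<^sup>k\<close> over an independent set of the \<open>k\<close>-th power, and the normalized
  indicator vectors of the \<open>T x\<close> form an orthonormal representation with the constant vector as
  handle. Both quantities are at least the size of an independent set. In a Hamming graph, the
  translates of a code of minimum distance \<open>d\<close> are such a family, and Hamming balls of radius
  \<open>(d - 1) div 2\<close> and subcubes of dimension \<open>d - 1\<close> are independent sets of the size required when
  the code is perfect or MDS. The repetition code is an MDS code with \<open>d = n\<close>.
\<close>

section \<open>Packings and the capacity\<close>

lemma finite_independent_sets:
  assumes "finite (pverts G)"
  shows "finite {S. independent_set G S}"
  by (rule finite_subset[of _ "Pow (pverts G)"]) (use assms in \<open>auto simp: independent_set_def\<close>)

lemma independent_set_empty: "independent_set G {}"
  by (simp add: independent_set_def)

lemma card_le_independence_number: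
  assumes "finite (pverts G)" "independent_set G S"
  shows "card S \<le> independence_number G"
  unfolding independence_number_def
  by (rule Max_ge) (use assms finite_independent_sets in auto)

lemma independence_number_le:
  assumes "finite (pverts G)" "\<And>S. independent_set G S \<Longrightarrow> card S \<le> b"
  shows "independence_number G \<le> b"
  unfolding independence_number_def
  using assms finite_independent_sets[OF assms(1)] independent_set_empty[of G]
  by (subst Max_le_iff) auto

lemma finite_pverts_strong_power:
  "finite (pverts G) \<Longrightarrow> finite (pverts (strong_power G k))"
  by (simp add: strong_power_def finite_PiE)

text \<open>The first strong power is a copy of \<open>G\<close> whose vertices are one-entry
  tuples, so the term \<open>k = 1\<close> of the supremum is already large enough.\<close>

lemma card_le_shannon_capacity:
  assumes fin: "finite (pverts G)" and S: "independent_set G S"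
  shows "ereal (real (card S)) \<le> shannon_capacity G"
proof -
  let ?f = "\<lambda>x. \<lambda>i\<in>{..<Suc 0}. x"
  have inj: "inj_on ?f S"
    by (rule inj_onI) (metis lessThan_iff restrict_apply zero_less_Suc)
  have "independent_set (strong_power G 1) (?f ` S)"
    using S by (auto simp: independent_set_def strong_power_def PiE_iff subset_iff)
  then have "card S \<le> independence_number (strong_power G 1)"
    using card_le_independence_number[OF finite_pverts_strong_power[OF fin]] card_image[OF inj]
    by metis
  then have "ereal (real (card S)) \<le> ereal (root 1 (real (independence_number (strong_power G 1))))"
    by simp
  also have "\<dots> \<le> shannon_capacity G"
    unfolding shannon_capacity_def by (rule SUP_upper) simp
  finally show ?thesis .
qed

text \<open>Dually, each \<open>w\<close> in \<open>W\<close> determines the clique of all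
  \<open>x\<close> with \<open>w \<in> T x\<close>. Giving each of these cliques weight 1/m yields a
  fractional clique cover of total weight |W|/m.\<close>

locale graph_packing =
  fixes G :: "'a pair_pre_digraph" and W :: "'b set" and T :: "'a \<Rightarrow> 'b set" and m :: nat
  assumes finite_W: "finite W"
    and T: "\<And>x. x \<in> pverts G \<Longrightarrow> T x \<subseteq> W \<and> card (T x) = m"
    and disj: "\<And>x y. x \<in> pverts G \<Longrightarrow> y \<in> pverts G \<Longrightarrow> x \<noteq> y \<Longrightarrow> (x, y) \<notin> parcs G \<Longrightarrow> T x \<inter> T y = {}"
    and fin: "finite (pverts G)"
    and m_pos: "0 < m"

text \<open>Distinct members of \<open>S\<close> are nonadjacent in the power, so in some coordinate
  their entries are distinct and nonadjacent. The sets \<open>T\<close> are disjoint there, which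
  separates the two boxes \<open>?P x\<close> and \<open>?P y\<close>.\<close>

lemma (in graph_packing) card_independent_set_strong_power_le:
  assumes S: "independent_set (strong_power G k) S"
  shows "card S * m ^ k \<le> card W ^ k"
proof -
  let ?P = "\<lambda>x. PiE {..<k} (\<lambda>i. T (x i))"
  have SV: "S \<subseteq> {..<k} \<rightarrow>\<^sub>E pverts G"
    using S by (simp add: independent_set_def strong_power_def)
  have finS: "finite S"
    using SV fin by (meson finite_PiE finite_lessThan finite_subset)
  have finT: "finite (T x)" if "x \<in> pverts G" for x
    using T[OF that] finite_W finite_subset by blast
  have cardP: "card (?P x) = m ^ k" if "x \<in> S" for x
  proof -
    have "\<And>i. i < k \<Longrightarrow> x i \<in> pverts G" using that SV by (auto simp: PiE_iff subset_iff)
    then show ?thesis by (simp add: card_PiE T)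
  qed
  have finP: "finite (?P x)" if "x \<in> S" for x
    using that SV finT by (intro finite_PiE) (auto simp: PiE_iff subset_iff)
  have disjP: "?P x \<inter> ?P y = {}" if xy: "x \<in> S" "y \<in> S" "x \<noteq> y" for x y
  proof (rule ccontr)
    assume "?P x \<inter> ?P y \<noteq> {}"
    then obtain z where z: "z \<in> ?P x" "z \<in> ?P y" by blast
    have "x i = y i \<or> (x i, y i) \<in> parcs G" if "i < k" for i
    proof -
      have "x i \<in> pverts G" "y i \<in> pverts G" using that xy SV by (auto simp: PiE_iff subset_iff)
      moreover have "z i \<in> T (x i) \<inter> T (y i)" using z that by (auto simp: PiE_iff)
      ultimately show ?thesis using disj by blast
    qed
    then have "(x, y) \<in> parcs (strong_power G k)"
      using xy SV by (auto simp: strong_power_def)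
    then show False using S xy by (auto simp: independent_set_def)
  qed
  have "card S * m ^ k = (\<Sum>x\<in>S. card (?P x))"
    by (simp add: cardP)
  also have "\<dots> = card (\<Union>x\<in>S. ?P x)"
    using finS finP disjP by (subst card_UN_disjoint) auto
  also have "\<dots> \<le> card ({..<k} \<rightarrow>\<^sub>E W)"
  proof (rule card_mono)
    show "finite ({..<k} \<rightarrow>\<^sub>E W)" using finite_W by (simp add: finite_PiE)
    show "(\<Union>x\<in>S. ?P x) \<subseteq> {..<k} \<rightarrow>\<^sub>E W"
    proof (rule UN_least)
      fix x assume "x \<in> S"
      then show "?P x \<subseteq> {..<k} \<rightarrow>\<^sub>E W"
        using SV T by (intro PiE_mono) (auto simp: PiE_iff subset_iff)
    qed
  qed
  also have "\<dots> = card W ^ k" by (simp add: card_PiE)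
  finally show ?thesis .
qed

lemma (in graph_packing) shannon_capacity_le:
  shows "shannon_capacity G \<le> ereal (real (card W) / real m)"
  unfolding shannon_capacity_def
proof (rule SUP_least)
  fix k :: nat assume "k \<in> {1..}"
  then have k: "0 < k" by simp
  obtain S where S: "independent_set (strong_power G k) S"
      "card S = independence_number (strong_power G k)"
  proof -
    have "independence_number (strong_power G k) \<in> card ` {S. independent_set (strong_power G k) S}"
      unfolding independence_number_def
      using finite_independent_sets[OF finite_pverts_strong_power[OF fin], of k]
        independent_set_empty[of "strong_power G k"] by (intro Max_in) auto
    then show ?thesis using that by auto
  qed
  have "card S * m ^ k \<le> card W ^ k"
    by (rule card_independent_set_strong_power_le[OF S(1)])
  then have "real (card S) * real m ^ k \<le> real (card W) ^ k"
    by (simp flip: of_nat_power of_nat_mult)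
  then have "real (card S) \<le> (real (card W) / real m) ^ k"
    using m_pos by (simp add: power_divide field_simps)
  then have "root k (real (card S)) \<le> root k ((real (card W) / real m) ^ k)"
    using k by simp
  also have "\<dots> = real (card W) / real m"
    using k by (simp add: real_root_power_cancel)
  finally show "ereal (root k (real (independence_number (strong_power G k))))
      \<le> ereal (real (card W) / real m)"
    by (simp add: S(2))
qed

section \<open>Packings and the theta function\<close>

text \<open>The squared norm of \<open>c\<close> minus its projection \<open>p\<close> onto the span
  of the \<open>u x\<close> is nonnegative, and the inner products of \<open>p\<close> with
  \<open>c\<close> and with itself both equal the sum on the left.\<close>

lemma bessel_inequality_vec:
  fixes u :: "'a \<Rightarrow> real vec"
  assumes "finite S" and c: "c \<in> carrier_vec m"
    and u: "\<And>x. x \<in> S \<Longrightarrow> u x \<in> carrier_vec m \<and> u x \<bullet> u x = 1"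
    and orth: "\<And>x y. x \<in> S \<Longrightarrow> y \<in> S \<Longrightarrow> x \<noteq> y \<Longrightarrow> u x \<bullet> u y = 0"
  shows "(\<Sum>x\<in>S. (c \<bullet> u x)\<^sup>2) \<le> c \<bullet> c"
proof -
  define a where "a x = c \<bullet> u x" for x
  define p where "p i = (\<Sum>x\<in>S. a x * u x $ i)" for i
  \<comment> \<open>\<open>scalar_prod\<close> sums up to the dimension of its second argument, here
    \<open>m\<close>.\<close>
  have sp: "v \<bullet> u x = (\<Sum>i<m. v $ i * u x $ i)" if "x \<in> S" for x v
    using u[OF that] by (auto simp: scalar_prod_def lessThan_atLeast0)
  have cc: "c \<bullet> c = (\<Sum>i<m. c $ i * c $ i)"
    using c by (auto simp: scalar_prod_def lessThan_atLeast0)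
  have proj: "(\<Sum>i<m. v $ i * p i) = (\<Sum>x\<in>S. a x * (v \<bullet> u x))" for v
  proof -
    have "(\<Sum>i<m. v $ i * p i) = (\<Sum>i<m. \<Sum>x\<in>S. a x * (v $ i * u x $ i))"
      by (simp add: p_def sum_distrib_left mult.left_commute)
    also have "\<dots> = (\<Sum>x\<in>S. \<Sum>i<m. a x * (v $ i * u x $ i))" by (rule sum.swap)
    finally show ?thesis by (simp add: sp sum_distrib_left)
  qed
  have cp: "(\<Sum>i<m. c $ i * p i) = (\<Sum>x\<in>S. (a x)\<^sup>2)"
    by (simp add: proj a_def power2_eq_square)
  have "(\<Sum>i<m. p i * p i) = (\<Sum>i<m. \<Sum>x\<in>S. a x * (u x $ i * p i))"
    by (subst (1) p_def) (simp only: sum_distrib_right mult.assoc)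
  also have "\<dots> = (\<Sum>x\<in>S. \<Sum>i<m. a x * (u x $ i * p i))" by (rule sum.swap)
  also have "\<dots> = (\<Sum>x\<in>S. a x * (\<Sum>i<m. u x $ i * p i))"
    by (simp add: sum_distrib_left)
  also have "\<dots> = (\<Sum>x\<in>S. (a x)\<^sup>2)"
  proof (rule sum.cong[OF refl])
    fix x assume x: "x \<in> S"
    \<comment> \<open>Taking \<open>v = u x\<close> in \<open>proj\<close>, orthonormality leaves
      only the term \<open>y = x\<close>.\<close>
    have "(\<Sum>i<m. u x $ i * p i) = (\<Sum>y\<in>S. if y = x then a y else 0)"
      unfolding proj using orth u x by (intro sum.cong refl) auto
    also have "\<dots> = a x" using x \<open>finite S\<close> by simp
    finally show "a x * (\<Sum>i<m. u x $ i * p i) = (a x)\<^sup>2" by (simp add: power2_eq_square)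
  qed
  finally have pp: "(\<Sum>i<m. p i * p i) = (\<Sum>x\<in>S. (a x)\<^sup>2)" .
  have "0 \<le> (\<Sum>i<m. (c $ i - p i)\<^sup>2)" by (intro sum_nonneg) simp
  also have "\<dots> = (\<Sum>i<m. c $ i * c $ i) - 2 * (\<Sum>i<m. c $ i * p i) + (\<Sum>i<m. p i * p i)"
    by (simp add: power2_eq_square algebra_simps sum.distrib sum_subtractf sum_distrib_left)
  finally show ?thesis using cc cp pp by (simp add: a_def)
qed

text \<open>An independent set receives pairwise orthogonal unit vectors. By Bessel's inequality the
  squares \<open>(c \<bullet> u x)\<^sup>2\<close> over \<open>S\<close> sum to at most 1, so one of
  them is at most the average 1/|S|, whatever representation and handle are chosen.\<close>

lemma card_le_lovasz_theta:
  assumes fin: "finite (pverts G)" and S: "independent_set G S" "S \<noteq> {}"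
  shows "ereal (real (card S)) \<le> lovasz_theta G"
  unfolding lovasz_theta_def
proof (rule Inf_greatest, clarify)
  fix m :: nat and c :: "real vec" and u
  assume c: "c \<in> carrier_vec m" "c \<bullet> c = 1" and u: "orthonormal_rep G m u"
  have SV: "S \<subseteq> pverts G" using S by (simp add: independent_set_def)
  have finS: "finite S" using SV fin finite_subset by blast
  have "(\<Sum>x\<in>S. (c \<bullet> u x)\<^sup>2) \<le> 1"
    unfolding c(2)[symmetric]
    by (rule bessel_inequality_vec[OF finS c(1)])
       (use u S SV in \<open>auto simp: orthonormal_rep_def independent_set_def subset_iff\<close>)
  then have "\<not> (\<forall>x\<in>S. 1 / real (card S) < (c \<bullet> u x)\<^sup>2)"
    using sum_strict_mono[OF finS S(2), of "\<lambda>_. 1 / real (card S)" "\<lambda>x. (c \<bullet> u x)\<^sup>2"] finS S(2)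
    by (auto simp: card_gt_0_iff)
  then obtain x where x: "x \<in> S" "(c \<bullet> u x)\<^sup>2 \<le> 1 / real (card S)" by force
  have "0 < card S" using finS S(2) by (simp add: card_gt_0_iff)
  have "ereal (real (card S)) \<le> 1 / ereal ((c \<bullet> u x)\<^sup>2)"
  \<comment> \<open>If \<open>u x\<close> is orthogonal to \<open>c\<close>, the quotient is
    infinite in \<open>ereal\<close> and the bound is trivial; otherwise it is an ordinary real
    quotient.\<close>
  proof (cases "c \<bullet> u x = 0")
    case True
    then show ?thesis by (simp add: divide_ereal_def flip: zero_ereal_def)
  next
    case False
    then have "0 < (c \<bullet> u x)\<^sup>2" by simp
    then have "real (card S) \<le> 1 / (c \<bullet> u x)\<^sup>2"
      using x(2) \<open>0 < card S\<close> by (simp add: field_simps)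
    then show ?thesis using False by (simp add: one_ereal_def)
  qed
  also have "\<dots> \<le> (MAX x\<in>pverts G. 1 / ereal ((c \<bullet> u x)\<^sup>2))"
    using fin x(1) SV by (intro Max_ge) auto
  finally show "ereal (real (card S)) \<le> (MAX x\<in>pverts G. 1 / ereal ((c \<bullet> u x)\<^sup>2))" .
qed

text \<open>With indicator vectors scaled to unit length, inner products become |T x \<inter> T y| /
  m, so disjoint sets give orthogonal vectors. The constant unit vector makes the same angle with
  every \<open>u x\<close>, since all \<open>T x\<close> have \<open>m\<close> elements.\<close>

lemma (in graph_packing) lovasz_theta_le:
  assumes ne: "pverts G \<noteq> {}"
  shows "lovasz_theta G \<le> ereal (real (card W) / real m)"
proof -
  define N where "N = card W"
  \<comment> \<open>Vector entries are indexed by natural numbers, so \<open>W\<close> is enumerated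
    first.\<close>
  obtain h where h: "bij_betw h {0..<N} W"
    using ex_bij_betw_nat_finite[OF finite_W] N_def by blast
  define c :: "real vec" where "c = vec N (\<lambda>_. 1 / sqrt (real N))"
  define u :: "'a \<Rightarrow> real vec"
    where "u x = vec N (\<lambda>i. if h i \<in> T x then 1 / sqrt (real m) else 0)" for x
  \<comment> \<open>Some vertex provides an \<open>m\<close>-element subset of \<open>W\<close>.
    Positivity of \<open>N\<close> is what makes \<open>c\<close> a unit vector.\<close>
  have "0 < N"
  proof -
    obtain x where "x \<in> pverts G" using ne by blast
    then have "m \<le> N" using T finite_W card_mono N_def by metis
    then show ?thesis using m_pos by simp
  qed
  have transfer: "(\<Sum>i\<in>{0..<N}. f (h i)) = (\<Sum>w\<in>W. f w)" for f :: "'b \<Rightarrow> real"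
    using sum.reindex_bij_betw[OF h] .
  have uu: "u x \<bullet> u y = real (card (T x \<inter> T y)) / real m"
    if "x \<in> pverts G" "y \<in> pverts G" for x y
  proof -
    have "u x \<bullet> u y = (\<Sum>i\<in>{0..<N}. if h i \<in> T x \<inter> T y then 1 / real m else 0)"
      by (auto simp: scalar_prod_def u_def intro!: sum.cong)
    also have "\<dots> = (\<Sum>w\<in>W. if w \<in> T x \<inter> T y then 1 / real m else 0)"
      by (rule transfer)
    also have "\<dots> = (\<Sum>w\<in>T x \<inter> T y. 1 / real m)"
      using T that finite_W by (intro sum.mono_neutral_cong_right) auto
    finally show ?thesis by simp
  qed
  have cu: "(c \<bullet> u x)\<^sup>2 = real m / real N" if "x \<in> pverts G" for x
  proof -
    have "c \<bullet> u x = (\<Sum>i\<in>{0..<N}. if h i \<in> T x then 1 / (sqrt (real N) * sqrt (real m)) else 0)"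
      by (auto simp: scalar_prod_def u_def c_def intro!: sum.cong)
    also have "\<dots> = (\<Sum>w\<in>W. if w \<in> T x then 1 / (sqrt (real N) * sqrt (real m)) else 0)"
      by (rule transfer)
    also have "\<dots> = (\<Sum>w\<in>T x. 1 / (sqrt (real N) * sqrt (real m)))"
      using T that finite_W by (intro sum.mono_neutral_cong_right) auto
    also have "\<dots> = real m / (sqrt (real N) * sqrt (real m))"
      using T that by simp
    finally show ?thesis
      using m_pos by (simp add: power_divide power_mult_distrib) (simp add: power2_eq_square)
  qed
  have "orthonormal_rep G N u"
    unfolding orthonormal_rep_def
  proof (intro conjI ballI impI)
    show "u x \<in> carrier_vec N" for x by (simp add: u_def)
    show "u x \<bullet> u x = 1" if "x \<in> pverts G" for x
      using uu[OF that that] T[OF that] m_pos by simp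
    show "u x \<bullet> u y = 0" if "x \<in> pverts G" "y \<in> pverts G" "x \<noteq> y \<and> (x, y) \<notin> parcs G" for x y
      using uu[OF that(1,2)] disj[OF that(1,2)] that(3) by simp
  qed
  moreover have "c \<in> carrier_vec N" "c \<bullet> c = 1"
    using \<open>0 < N\<close> by (simp_all add: c_def scalar_prod_def)
  ultimately have "lovasz_theta G \<le> (MAX x\<in>pverts G. 1 / ereal ((c \<bullet> u x)\<^sup>2))"
    unfolding lovasz_theta_def by (intro Inf_lower) blast
  \<comment> \<open>Every vertex contributes the same value by \<open>cu\<close>, so the maximum is
    that of a constant.\<close>
  also have "\<dots> = (MAX x\<in>pverts G. ereal (real N / real m))"
    using cu m_pos \<open>0 < N\<close> by (intro arg_cong[of _ _ Max] image_cong) (auto simp: one_ereal_def)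
  also have "\<dots> = ereal (real N / real m)"
    using ne by (simp add: image_constant_conv)
  finally show ?thesis by (simp add: N_def)
qed

text \<open>Both quantities lie between |S| and |W|/m, and the counting hypothesis makes these two
  bounds coincide.\<close>

lemma (in graph_packing) lovasz_theta_eq_shannon_capacity:
  assumes S: "independent_set G S" "S \<noteq> {}" "card S * m = card W"
  shows "lovasz_theta G = shannon_capacity G"
proof -
  have "pverts G \<noteq> {}" using S(1,2) by (auto simp: independent_set_def)
  have "real (card W) / real m = real (card S)"
    using m_pos by (simp add: S(3)[symmetric])
  then have upper: "lovasz_theta G \<le> ereal (real (card S))" "shannon_capacity G \<le> ereal (real (card S))"
    using lovasz_theta_le[OF \<open>pverts G \<noteq> {}\<close>] shannon_capacity_le by (simp_all only:)
  have "lovasz_theta G = ereal (real (card S))"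
    by (rule antisym[OF upper(1) card_le_lovasz_theta[OF fin S(1,2)]])
  also have "\<dots> = shannon_capacity G"
    by (rule antisym[OF card_le_shannon_capacity[OF fin S(1)] upper(2)])
  finally show ?thesis .
qed

section \<open>Hamming graphs\<close>

lemma finite_words: "finite (words q n)"
  by (simp add: words_def finite_PiE)

lemma card_words: "card (words q n) = q ^ n"
  by (simp add: words_def card_PiE)

section \<open>The Hamming metric and translations of codes\<close>

lemma hamming_dist_triangle: "hamming_dist n x z \<le> hamming_dist n x y + hamming_dist n y z"
proof -
  have "hamming_dist n x z \<le> card ({i \<in> {..<n}. x i \<noteq> y i} \<union> {i \<in> {..<n}. y i \<noteq> z i})"
    unfolding hamming_dist_def by (intro card_mono) auto
  also have "\<dots> \<le> hamming_dist n x y + hamming_dist n y z"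
    unfolding hamming_dist_def by (rule card_Un_le)
  finally show ?thesis .
qed

lemma hamming_dist_commute: "hamming_dist n x y = hamming_dist n y x"
  by (simp add: hamming_dist_def eq_commute)

text \<open>Addition in the group (Z/q)^n; \<open>restrict\<close> keeps the result extensional, as
  membership in \<open>words\<close> demands.\<close>

definition translate :: "nat \<Rightarrow> nat \<Rightarrow> (nat \<Rightarrow> nat) \<Rightarrow> (nat \<Rightarrow> nat) \<Rightarrow> nat \<Rightarrow> nat" where
  "translate q n x c = (\<lambda>i\<in>{..<n}. (x i + c i) mod q)"

lemma translate_in_words: "0 < q \<Longrightarrow> translate q n x c \<in> words q n"
  by (auto simp: translate_def words_def)

lemma add_mod_cancel:
  fixes a b c q :: nat
  assumes "(c + a) mod q = (c + b) mod q" "a < q" "b < q"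
  shows "a = b"
proof -
  have "[a = b] (mod q)"
    using assms(1)[folded cong_def] by (simp only: cong_add_lcancel_nat)
  then show ?thesis using assms by (simp add: cong_def)
qed

lemma words_eqI: "x \<in> words q n \<Longrightarrow> y \<in> words q n \<Longrightarrow> (\<And>i. i < n \<Longrightarrow> x i = y i) \<Longrightarrow> x = y"
  unfolding words_def by (rule PiE_ext) auto

lemma inj_on_translate: "inj_on (translate q n x) (words q n)"
proof (rule inj_onI)
  fix a b assume a: "a \<in> words q n" and b: "b \<in> words q n" and eq: "translate q n x a = translate q n x b"
  show "a = b"
  proof (rule words_eqI[OF a b])
    fix i assume i: "i < n"
    have "(x i + a i) mod q = (x i + b i) mod q"
      using fun_cong[OF eq, of i] i by (simp add: translate_def)
    then show "a i = b i"
      by (rule add_mod_cancel) (use a b i in \<open>auto simp: words_def\<close>)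
  qed
qed

text \<open>From x + a = y + b follows x - y = b - a modulo q, and both differences vanish in the
  same coordinates.\<close>

lemma hamming_dist_translate_eq:
  assumes w: "x \<in> words q n" "y \<in> words q n" "a \<in> words q n" "b \<in> words q n"
    and eq: "translate q n x a = translate q n y b"
  shows "hamming_dist n x y = hamming_dist n a b"
proof -
  have "x i = y i \<longleftrightarrow> a i = b i" if i: "i < n" for i
  proof -
    have *: "(x i + a i) mod q = (y i + b i) mod q"
      using fun_cong[OF eq, of i] i by (simp add: translate_def)
    have lt: "x i < q" "y i < q" "a i < q" "b i < q"
      using w i by (auto simp: words_def)
    show ?thesis
    proof
      assume "x i = y i"
      then have "(x i + a i) mod q = (x i + b i) mod q" using * by simp
      then show "a i = b i" by (rule add_mod_cancel[OF _ lt(3,4)])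
    next
      assume "a i = b i"
      then have "(a i + x i) mod q = (a i + y i) mod q" using * by (simp add: add.commute)
      then show "x i = y i" by (rule add_mod_cancel[OF _ lt(1,2)])
    qed
  qed
  then show ?thesis unfolding hamming_dist_def by (intro arg_cong[of _ _ card]) auto
qed

text \<open>Reduces each case to an anticode \<open>S\<close> of diameter below \<open>d\<close>
  that meets the code-anticode bound with \<open>C\<close>. Such an \<open>S\<close> is independent.
  If the translates of \<open>C\<close> by two distinct words meet, these words are as far apart as
  two distinct codewords, hence adjacent.\<close>

lemma lovasz_theta_hamming_graph:
  assumes "0 < q" and "1 \<le> d" and C: "C \<subseteq> words q n" "has_min_distance n C d"
    and S: "S \<subseteq> words q n" "\<And>x y. x \<in> S \<Longrightarrow> y \<in> S \<Longrightarrow> hamming_dist n x y < d"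
    and card: "card S * card C = q ^ n"
  shows "lovasz_theta (hamming_graph q n d) = shannon_capacity (hamming_graph q n d)"
proof -
  let ?G = "hamming_graph q n d"
  have V: "pverts ?G = words q n" by (simp add: hamming_graph_def)
  have "0 < card S * card C" using card \<open>0 < q\<close> by simp
  then have pos: "0 < card C" "S \<noteq> {}" by (auto intro: gr0I)
  interpret graph_packing ?G "words q n" "\<lambda>x. translate q n x ` C" "card C"
  proof
    show "finite (words q n)" "finite (pverts ?G)" by (simp_all add: V finite_words)
    show "0 < card C" by (rule pos(1))
    show "translate q n x ` C \<subseteq> words q n \<and> card (translate q n x ` C) = card C" for x
      using translate_in_words[OF \<open>0 < q\<close>] card_image[OF inj_on_subset[OF inj_on_translate C(1)]]
      by auto
    show "translate q n x ` C \<inter> translate q n y ` C = {}"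
      if xy: "x \<in> pverts ?G" "y \<in> pverts ?G" "x \<noteq> y" "(x, y) \<notin> parcs ?G" for x y
    proof (rule ccontr)
      assume "translate q n x ` C \<inter> translate q n y ` C \<noteq> {}"
      then obtain a b where ab: "a \<in> C" "b \<in> C" "translate q n x a = translate q n y b" by blast
      have dist: "hamming_dist n x y = hamming_dist n a b"
        using xy ab C(1) by (intro hamming_dist_translate_eq[where q = q]) (auto simp: V)
      \<comment> \<open>The minimum distance speaks only of distinct codewords; equal ones would
        force \<open>x = y\<close>.\<close>
      have "a \<noteq> b"
      proof
        assume "a = b"
        then have "hamming_dist n x y = 0" using dist by (simp add: hamming_dist_def)
        then have "x = y" using xy by (intro words_eqI[of x q n]) (auto simp: V hamming_dist_def)
        then show False using xy by simp
      qed
      then have "d \<le> hamming_dist n x y"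
        using C(2) ab dist by (simp add: has_min_distance_def)
      then show False using xy by (simp add: hamming_graph_def)
    qed
  qed
  show ?thesis
  proof (rule lovasz_theta_eq_shannon_capacity[OF _ pos(2)])
    show "independent_set ?G S"
      using S by (fastforce simp: independent_set_def hamming_graph_def)
    show "card S * card C = card (words q n)" by (simp add: card card_words)
  qed
qed

section \<open>Hamming balls and perfect codes\<close>

lemma card_words_support:
  assumes "A \<subseteq> {..<n}" and "0 < q"
  shows "card {y \<in> words q n. {i \<in> {..<n}. y i \<noteq> 0} = A} = (q - 1) ^ card A"
proof -
  \<comment> \<open>Words with support \<open>A\<close> form a box: \<open>q - 1\<close> nonzero
    letters on \<open>A\<close>, only 0 off it.\<close>
  have "{y \<in> words q n. {i \<in> {..<n}. y i \<noteq> 0} = A}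
      = PiE {..<n} (\<lambda>i. if i \<in> A then {1..<q} else {0})"
    (is "?L = ?R")
  proof (intro equalityI subsetI)
    fix y assume y: "y \<in> ?L"
    then have "y \<in> {..<n} \<rightarrow>\<^sub>E {..<q}" "\<And>i. i < n \<Longrightarrow> i \<in> A \<longleftrightarrow> y i \<noteq> 0"
      by (auto simp: words_def)
    then show "y \<in> ?R" by (simp add: PiE_iff Suc_le_eq)
  next
    fix y assume y: "y \<in> ?R"
    have val: "y i < q \<and> (i \<in> A \<longleftrightarrow> y i \<noteq> 0)" if "i < n" for i
      using PiE_mem[OF y, of i] that \<open>0 < q\<close> by (simp split: if_splits)
    then have "{i \<in> {..<n}. y i \<noteq> 0} = A" using assms(1) by blast
    moreover have "y \<in> words q n" using y val by (simp add: words_def PiE_iff)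
    ultimately show "y \<in> ?L" by simp
  qed
  also have "card \<dots> = (\<Prod>i<n. if i \<in> A then q - 1 else 1)"
    by (simp add: card_PiE if_distrib cong: if_cong)
  also have "\<dots> = (q - 1) ^ card A"
    using assms by (simp add: prod.If_cases Int_absorb1)
  finally show ?thesis .
qed

text \<open>The words of the ball are sorted by their support, which has at most \<open>r\<close>
  elements; there are \<open>n choose i\<close> supports of size \<open>i\<close>.\<close>

lemma card_hamming_ball:
  assumes "0 < q"
  shows "card {y \<in> words q n. hamming_dist n y (\<lambda>_. 0) \<le> r} = (\<Sum>i = 0..r. (n choose i) * (q - 1) ^ i)"
proof -
  let ?F = "\<lambda>A. {y \<in> words q n. {i \<in> {..<n}. y i \<noteq> 0} = A}"
  let ?K = "\<lambda>i. {A. A \<subseteq> {..<n} \<and> card A = i}"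
  have finK: "finite (?K i)" for i
    by (rule finite_subset[of _ "Pow {..<n}"]) auto
  have "{y \<in> words q n. hamming_dist n y (\<lambda>_. 0) \<le> r} = (\<Union>A\<in>(\<Union>i\<in>{0..r}. ?K i). ?F A)"
    by (auto simp: hamming_dist_def)
  also have "card \<dots> = (\<Sum>A\<in>(\<Union>i\<in>{0..r}. ?K i). card (?F A))"
    using finK by (intro card_UN_disjoint) (auto simp: finite_words)
  also have "\<dots> = (\<Sum>i = 0..r. \<Sum>A\<in>?K i. card (?F A))"
    using finK by (intro sum.UNION_disjoint) auto
  also have "\<dots> = (\<Sum>i = 0..r. \<Sum>A\<in>?K i. (q - 1) ^ i)"
    using assms by (intro sum.cong refl) (simp add: card_words_support del: neq0_conv lessThan_iff)
  also have "\<dots> = (\<Sum>i = 0..r. (n choose i) * (q - 1) ^ i)"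
    by (simp add: n_subsets)
  finally show ?thesis .
qed

text \<open>The ball of radius \<open>(d - 1) div 2\<close> is the anticode: its diameter is at most
  \<open>d - 1\<close> by the triangle inequality, and equality in the Hamming bound is the required
  product formula.\<close>

lemma lovasz_theta_perfect_code:
  assumes "0 < q" and "1 \<le> d" and C: "perfect_code q n d C"
  shows "lovasz_theta (hamming_graph q n d) = shannon_capacity (hamming_graph q n d)"
proof (rule lovasz_theta_hamming_graph[where C = C])
  let ?r = "(d - 1) div 2"
  define b where "b = (\<Sum>i = 0..?r. (n choose i) * (q - 1) ^ i)"
  let ?S = "{y \<in> words q n. hamming_dist n y (\<lambda>_. 0) \<le> ?r}"
  show "hamming_dist n x y < d" if "x \<in> ?S" "y \<in> ?S" for x y
    using that hamming_dist_triangle[of n x y "\<lambda>_. 0"] hamming_dist_commute[of n y "\<lambda>_. 0"] \<open>1 \<le> d\<close>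
    by auto
  \<comment> \<open>The term for \<open>i = 0\<close> is 1, so the denominator of the Hamming bound
    is positive and can be cleared.\<close>
  have "(n choose 0) * (q - 1) ^ 0 \<le> b"
    unfolding b_def by (rule member_le_sum) auto
  then have "0 < b" by simp
  then have "real (card C) * real b = real (q ^ n)"
    using C unfolding perfect_code_def b_def[symmetric] by simp
  then have "card C * b = q ^ n"
    by (simp only: of_nat_eq_iff flip: of_nat_mult)
  then show "card ?S * card C = q ^ n"
    by (simp only: card_hamming_ball[OF \<open>0 < q\<close>] b_def mult.commute)
qed (use assms in \<open>auto simp: perfect_code_def\<close>)

section \<open>MDS codes and the repetition code\<close>

lemma lovasz_theta_mds_code:
  assumes "0 < q" and "1 \<le> d" and "d \<le> n" and C: "mds_code q n d C"
  shows "lovasz_theta (hamming_graph q n d) = shannon_capacity (hamming_graph q n d)"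
proof (rule lovasz_theta_hamming_graph[where C = C])
  \<comment> \<open>The anticode is a subcube: the first \<open>d - 1\<close> coordinates are free
    and the others are 0, so two members differ in at most \<open>d - 1\<close> places.\<close>
  let ?S = "PiE {..<n} (\<lambda>i. if i < d - 1 then {..<q} else {0})"
  show "?S \<subseteq> words q n"
    unfolding words_def using \<open>0 < q\<close> by (intro PiE_mono) auto
  show "hamming_dist n x y < d" if "x \<in> ?S" "y \<in> ?S" for x y
  proof -
    have "{i \<in> {..<n}. x i \<noteq> y i} \<subseteq> {..<d - 1}"
    proof clarsimp
      fix i assume "i < n" "x i \<noteq> y i"
      then show "i < d - Suc 0"
        using PiE_mem[OF that(1), of i] PiE_mem[OF that(2), of i] by (auto split: if_splits)
    qed
    then have "hamming_dist n x y \<le> card {..<d - 1}"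
      unfolding hamming_dist_def by (intro card_mono) auto
    then show ?thesis using \<open>1 \<le> d\<close> by simp
  qed
  have "card ?S = (\<Prod>i<n. if i < d - 1 then q else 1)"
    by (simp add: card_PiE if_distrib cong: if_cong)
  also have "\<dots> = q ^ card ({..<n} \<inter> {i. i < d - 1})"
    by (simp add: prod.If_cases)
  also have "{..<n} \<inter> {i. i < d - 1} = {..<d - 1}" using \<open>d \<le> n\<close> by auto
  finally have "card ?S = q ^ (d - 1)" by simp
  \<comment> \<open>The truncated subtractions are exact because \<open>1 \<le> d\<close> and
    \<open>d \<le> n\<close>.\<close>
  moreover have "d - 1 + (n - d + 1) = n" using assms by simp
  ultimately show "card ?S * card C = q ^ n"
    using C unfolding mds_code_def by (simp only: flip: power_add)
qed (use assms in \<open>auto simp: mds_code_def\<close>)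

text \<open>Distinct constant words differ in all \<open>n\<close> positions, and for
  \<open>d = n\<close> the Singleton bound is q^1, the number of constant words.\<close>

lemma mds_code_repetition:
  assumes "2 \<le> q" and "1 \<le> n"
  shows "mds_code q n n ((\<lambda>a. \<lambda>i\<in>{..<n}. a) ` {..<q})"
proof -
  let ?f = "\<lambda>a. \<lambda>i\<in>{..<n}. a :: nat"
  have dist: "hamming_dist n (?f a) (?f b) = n" if "a \<noteq> b" for a b
  proof -
    have "{i \<in> {..<n}. ?f a i \<noteq> ?f b i} = {..<n}" using that by auto
    then show ?thesis by (simp add: hamming_dist_def)
  qed
  have neq: "?f a \<noteq> ?f b" if "a \<noteq> b" for a b
  proof
    assume "?f a = ?f b"
    then have "?f a 0 = ?f b 0" by (rule fun_cong)
    then show False using that \<open>1 \<le> n\<close> by simp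
  qed
  then have "inj_on ?f {..<q}" by (meson inj_onI)
  then have "card (?f ` {..<q}) = q" by (simp add: card_image)
  moreover have "has_min_distance n (?f ` {..<q}) n"
    unfolding has_min_distance_def
  proof (intro conjI ballI impI)
    \<comment> \<open>\<open>has_min_distance\<close> asks for a pair attaining the distance;
      \<open>2 \<le> q\<close> supplies the letters 0 and 1.\<close>
    have "?f 0 \<in> ?f ` {..<q}" "?f 1 \<in> ?f ` {..<q}"
      by (rule imageI, use \<open>2 \<le> q\<close> in simp)+
    moreover have "?f 0 \<noteq> ?f 1" "hamming_dist n (?f 0) (?f 1) = n"
      by (rule neq dist, simp)+
    ultimately show "\<exists>x\<in>?f ` {..<q}. \<exists>y\<in>?f ` {..<q}. x \<noteq> y \<and> hamming_dist n x y = n" by blast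
    show "n \<le> hamming_dist n x y" if xy: "x \<in> ?f ` {..<q}" "y \<in> ?f ` {..<q}" "x \<noteq> y" for x y
    proof -
      obtain a b where ab: "x = ?f a" "y = ?f b" using xy(1,2) by blast
      then have "a \<noteq> b" using xy(3) by blast
      from eq_refl[OF dist[OF this, symmetric]] show ?thesis unfolding ab .
    qed
  qed
  ultimately show ?thesis by (auto simp: mds_code_def words_def split: if_splits)
qed

theorem lemma20:
  fixes q n d :: nat
  assumes "2 \<le> q" and "1 \<le> d" and "d \<le> n"
  shows "((\<exists>C. perfect_code q n d C) \<longrightarrow>
            lovasz_theta (hamming_graph q n d) = shannon_capacity (hamming_graph q n d)) \<and>
         (q \<ge> n - d + 2 \<and> (\<exists>C. mds_code q n d C) \<longrightarrow>
            lovasz_theta (hamming_graph q n d) = shannon_capacity (hamming_graph q n d)) \<and>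
         lovasz_theta (hamming_graph q n n) = shannon_capacity (hamming_graph q n n)"
proof -
  have "0 < q" "1 \<le> n" using assms by simp_all
  \<comment> \<open>The third claim is the MDS case with \<open>d = n\<close>, applied to the
    repetition code.\<close>
  then show ?thesis
    using lovasz_theta_perfect_code[of q d n] lovasz_theta_mds_code[of q d n] \<open>1 \<le> d\<close> \<open>d \<le> n\<close>
      lovasz_theta_mds_code[OF _ _ order_refl mds_code_repetition[OF \<open>2 \<le> q\<close>]]
    by blast
qed

end
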